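(* Let $\mathbb H=(V,\mathcal H)$ be a connected hypergraph. If a hyperedge of $\mathbb H$ contains two nodes of degree $1$, i.e. there exist $H\in\mathcal H$ and distinct $i,j\in H$ such that $d(i)=d(j)=1$, then the model cannot be stable, i.e. $\mathrm{Stab}(\mathbb H,\Phi)=\emptyset$ for any admissible matching policy $\Phi$.
   Context: A hypergraph $\mathbb H=(V,\mathcal H)$ consists of a finite node set $V$ and a finite set $\mathcal H$ of subsets of $V$ (hyperedges) with union $V$. All hypergraphs are assumed simple (no hyperedge is contained in another one) and connected (the graph whose vertices are the hyperedges, with two hyperedges adjacent when they intersect, is connected). The degree $d(i)$ of a node $i$ is the number of hyperedges containing $i$. $\mathscr M(V)$ is the set of probability measures $\mu$ on $V$ with $\mu(i)>0$ for all $i$. Matching model $(\mathbb H,\Phi,\mu)$: at each time $n\ge1$ one item enters; its class $C_n\in V$ is drawn from $\mu$, i.i.d. If the buffer contains a set of items whose classes form, together with $C_n$, a hyperedge (one item per class), the policy $\Phi$ selects one such set and these items leave immediately together with the incoming item (a match is always performed whenever possible); otherwise the incoming item is stored. $W_n$ is the word over $V$ listing the classes of unmatched items after the arrival at time $n$, in order of arrival; it takes values in the set of words in which, for each hyperedge, some class of the hyperedge does not occur. $\Phi$ is admissible if the choice of the match depends solely on the queue detail (the word) upon arrival and the incoming class, and possibly on an independent uniform draw in case of a tie; then $(W_n)$ is a Markov chain. The model is stable if $(W_n)$ is positive recurrent; $\mathrm{Stab}(\mathbb H,\Phi)$ is the set of $\mu\in\mathscr M(V)$ for which it is stable. *)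

theory Defs
  imports "HOL-Probability.Probability"
begin

section \<open>Hypergraphs\<close>

definition hypergraph :: "'a set \<Rightarrow> 'a set set \<Rightarrow> bool" where
  "hypergraph V E \<longleftrightarrow> finite V \<and> \<Union>E = V"

definition simple_hypergraph :: "'a set set \<Rightarrow> bool" where
  "simple_hypergraph E \<longleftrightarrow> (\<forall>A\<in>E. \<forall>B\<in>E. A \<subseteq> B \<longrightarrow> A = B)"

definition connected_hypergraph :: "'a set set \<Rightarrow> bool" where
  "connected_hypergraph E \<longleftrightarrow>
     (\<forall>A\<in>E. \<forall>B\<in>E. (A, B) \<in> {(X, Y). X \<in> E \<and> Y \<in> E \<and> X \<inter> Y \<noteq> {}}\<^sup>*)"

definition node_degree :: "'a set set \<Rightarrow> 'a \<Rightarrow> nat" where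
  "node_degree E i = card {H \<in> E. i \<in> H}"

definition full_support_measures :: "'a set \<Rightarrow> 'a measure set" where
  "full_support_measures V =
     {\<mu>. prob_space \<mu> \<and> sets \<mu> = Pow V \<and> (\<forall>i\<in>V. measure \<mu> {i} > 0)}"


section \<open>Matching policies\<close>

definition buffer_words :: "'a set \<Rightarrow> 'a set set \<Rightarrow> 'a list set" where
  "buffer_words V E = {w \<in> lists V. \<forall>H\<in>E. \<not> H \<subseteq> set w}"

text \<open>
  The stored items are identified with the positions of the word \<open>w\<close> (oldest first).
  A possible match of an incoming item of class \<open>c\<close> is a set of positions carrying pairwise
  distinct classes, all different from \<open>c\<close>, which form a hyperedge together with \<open>c\<close>.
  It is empty exactly when it is the match of \<open>c\<close> alone, for a hyperedge \<open>{c}\<close>.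
\<close>

definition matches :: "'a set set \<Rightarrow> 'a list \<Rightarrow> 'a \<Rightarrow> nat set set" where
  "matches E w c =
     {S. S \<subseteq> {..<length w} \<and> inj_on ((!) w) S \<and> c \<notin> (!) w ` S \<and> insert c ((!) w ` S) \<in> E}"

definition uniform_draw :: "real measure" where
  "uniform_draw = restrict_space lborel {0..1}"

text \<open>
  A policy maps the word upon arrival, the incoming class and the current uniform draw to the set
  of positions of the matched items. Its value is only relevant when a match is possible.
  Ties are broken by means of the draw; deterministic policies ignore it.
\<close>

type_synonym 'a policy = "'a list \<Rightarrow> 'a \<Rightarrow> real \<Rightarrow> nat set"

definition admissible :: "'a set \<Rightarrow> 'a set set \<Rightarrow> 'a policy \<Rightarrow> bool" where
  "admissible V E \<Phi> \<longleftrightarrow>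
     (\<forall>w\<in>buffer_words V E. \<forall>c\<in>V. matches E w c \<noteq> {} \<longrightarrow>
        \<Phi> w c \<in> uniform_draw \<rightarrow>\<^sub>M count_space (matches E w c))"


section \<open>The buffer content process and stability\<close>

definition next_word :: "'a set set \<Rightarrow> 'a policy \<Rightarrow> 'a list \<Rightarrow> 'a \<times> real \<Rightarrow> 'a list" where
  "next_word E \<Phi> w = (\<lambda>(c, u).
     if matches E w c = {} then w @ [c] else nths w (- \<Phi> w c u))"

text \<open>
  \<open>\<omega> !! n\<close> is the pair of the class and the uniform draw of the item entering at time \<open>n + 1\<close>.
\<close>

definition arrivals :: "'a measure \<Rightarrow> ('a \<times> real) stream measure" where
  "arrivals \<mu> = stream_space (\<mu> \<Otimes>\<^sub>M uniform_draw)"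

primrec buffer ::
  "'a set set \<Rightarrow> 'a policy \<Rightarrow> 'a list \<Rightarrow> ('a \<times> real) stream \<Rightarrow> nat \<Rightarrow> 'a list" where
  "buffer E \<Phi> w \<omega> 0 = w"
| "buffer E \<Phi> w \<omega> (Suc n) = next_word E \<Phi> (buffer E \<Phi> w \<omega> n) (\<omega> !! n)"

text \<open>The infimum is \<open>\<infinity>\<close> if the initial word is never visited again.\<close>

definition return_time ::
  "'a set set \<Rightarrow> 'a policy \<Rightarrow> 'a list \<Rightarrow> ('a \<times> real) stream \<Rightarrow> ennreal" where
  "return_time E \<Phi> w \<omega> = (INF n\<in>{n. n \<ge> 1 \<and> buffer E \<Phi> w \<omega> n = w}. of_nat n)"

text \<open>
  Positive recurrence of the chain: every state has finite mean return time. All states are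
  accessible from the empty word (the letters of the word arriving in order are all stored), so
  this also forces the chain to be irreducible.
\<close>

definition stable :: "'a set \<Rightarrow> 'a set set \<Rightarrow> 'a policy \<Rightarrow> 'a measure \<Rightarrow> bool" where
  "stable V E \<Phi> \<mu> \<longleftrightarrow>
     (\<forall>w\<in>buffer_words V E. (\<integral>\<^sup>+\<omega>. return_time E \<Phi> w \<omega> \<partial>arrivals \<mu>) < \<infinity>)"

definition Stab :: "'a set \<Rightarrow> 'a set set \<Rightarrow> 'a policy \<Rightarrow> 'a measure set" where
  "Stab V E \<Phi> = {\<mu> \<in> full_support_measures V. stable V E \<Phi> \<mu>}"

end

theory Submission
  imports Defs
begin

text \<open>
  If \<open>i\<close> and \<open>j\<close> have degree \<open>1\<close> and share a hyperedge, every hyperedge contains both of them or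
  neither. A match can therefore change the difference between the numbers of stored items of
  classes \<open>i\<close> and \<open>j\<close> only through the class of the incoming item: whatever the policy does, this
  difference is a random walk on the integers, with steps \<open>1\<close>, \<open>-1\<close> and \<open>0\<close> of probabilities
  \<open>\<mu>(i)\<close>, \<open>\<mu>(j)\<close> and \<open>1 - \<mu>(i) - \<mu>(j)\<close> (lemma \<open>excess_buffer\<close>). The initially empty buffer cannot be
  empty again before this walk is back at \<open>0\<close>, so it suffices that the mean return time of the walk is infinite.

  By symmetry let \<open>p = \<mu>(i) \<ge> q = \<mu>(j)\<close>, so that the walk does not drift downwards, and let
  \<open>f k\<close> be the mean time to reach \<open>0\<close> from \<open>k > 0\<close>. If \<open>f 1\<close> were finite, conditioning on the
  first step would give \<open>f k \<ge> 1 + p f (k + 1) + q f (k - 1) + (1 - p - q) f k\<close> with all values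
  finite, that is \<open>p (f (k + 1) - f k) \<le> q (f k - f (k - 1)) - 1\<close>. As \<open>q \<le> p \<le> 1\<close>, the
  increments of \<open>f\<close> decrease by at least one per step until they are at most \<open>-1\<close>, and stay there;
  so \<open>f\<close> would become negative (lemma \<open>drift_inequality_infeasible\<close>). This covers the transient
  case \<open>p > q\<close> and the null recurrent case \<open>p = q\<close> alike.
\<close>

section \<open>A drift inequality without nonnegative solutions\<close>

text \<open>
  The inequality says that \<open>f\<close> loses at least one unit per step in mean along a walk with upward
  drift \<open>p - q \<ge> 0\<close>. This pushes the increments of \<open>f\<close> down to \<open>-1\<close> or less, and then \<open>f\<close> itself
  below \<open>0\<close>.
\<close>

lemma drift_inequality_infeasible:
  fixes f :: "nat \<Rightarrow> real"
  assumes nonneg: "\<And>k. 0 \<le> f k"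
    and pq: "0 < p" "p \<le> 1" "0 \<le> q" "q \<le> p"
    and drift: "\<And>k. 1 + p * f (k + 2) + q * f k + (1 - p - q) * f (k + 1) \<le> f (k + 1)"
  shows False
proof -
  define d where "d k = f (Suc k) - f k" for k
  have step: "p * d (Suc k) \<le> q * d k - 1" for k
    using drift[of k] by (simp add: d_def algebra_simps)
  have d_step: "d (Suc k) \<le> max 0 (d k) - 1" for k
  proof -
    have "q * d k \<le> p * max 0 (d k)"
    proof (cases "0 \<le> d k")
      case True
      then show ?thesis
        using pq by (simp add: mult_right_mono)
    next
      case False
      then show ?thesis
        using pq by (simp add: mult_nonneg_nonpos)
    qed
    then have "p * d (Suc k) \<le> p * max 0 (d k) - p"
      using step[of k] pq by linarith
    then have "p * d (Suc k) \<le> p * (max 0 (d k) - 1)"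
      by (simp add: algebra_simps)
    then show ?thesis
      using pq by simp
  qed
  have d_bound: "d k \<le> max (d 0 - real k) (-1)" if "k \<ge> 1" for k
    using that
  proof (induction k rule: dec_induct)
    case base
    show ?case using d_step[of 0] by auto
  next
    case (step k)
    then show ?case using d_step[of k] by auto
  qed
  obtain N' :: nat where "d 0 + 1 < real N'"
    using reals_Archimedean2 by blast
  then obtain N :: nat where N: "d 0 + 1 \<le> real N" "N \<ge> 1"
    by (intro that[of "Suc N'"]) auto
  have "f (N + m) \<le> f N - real m" for m
  proof (induction m)
    case (Suc m)
    have "d (N + m) \<le> -1"
      using d_bound[of "N + m"] N by auto
    then show ?case
      using Suc by (simp add: d_def)
  qed simp
  moreover obtain m :: nat where "f N < real m"
    using reals_Archimedean2 by blast
  ultimately have "f (N + m) < 0"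
    by (smt (verit))
  then show False
    using nonneg[of "N + m"] by simp
qed

lemma drift_inequality_infinite:
  fixes f :: "nat \<Rightarrow> ennreal"
  assumes pq: "0 < p" "0 \<le> q" "q \<le> p" "p + q \<le> 1"
    and zero: "f 0 = 0"
    and drift: "\<And>k. 1 + ennreal p * f (k + 2) + ennreal q * f k + ennreal (1 - p - q) * f (k + 1)
                      \<le> f (k + 1)"
  shows "f 1 = \<infinity>"
proof (rule ccontr)
  assume "f 1 \<noteq> \<infinity>"
  have Suc_finite: "f (Suc k) \<noteq> \<infinity>" for k
  proof (induction k)
    case (Suc k)
    show ?case
    proof
      assume "f (Suc (Suc k)) = \<infinity>"
      then show False
        using drift[of k] Suc pq by (simp add: ennreal_mult_top top_unique)
    qed
  qed (use \<open>f 1 \<noteq> \<infinity>\<close> in simp)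
  define g where "g k = enn2real (f k)" for k
  have f_g: "f k = ennreal (g k)" for k
    using Suc_finite zero by (cases k) (auto simp: g_def less_top)
  have g_nonneg: "0 \<le> g k" for k
    by (simp add: g_def)
  show False
  proof (rule drift_inequality_infeasible[of g p q])
    show "1 + p * g (k + 2) + q * g k + (1 - p - q) * g (k + 1) \<le> g (k + 1)" for k
    proof -
      have "ennreal (1 + p * g (k + 2) + q * g k + (1 - p - q) * g (k + 1)) \<le> ennreal (g (k + 1))"
        using drift[of k] pq g_nonneg unfolding f_g
        by (simp add: ennreal_mult ennreal_1[symmetric] del: ennreal_1)
      then show ?thesis
        using g_nonneg by simp
    qed
  qed (use pq g_nonneg in auto)
qed

section \<open>Return times of walks with steps \<open>1\<close>, \<open>-1\<close> and \<open>0\<close>\<close>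

definition walk :: "('b \<Rightarrow> int) \<Rightarrow> int \<Rightarrow> 'b stream \<Rightarrow> nat \<Rightarrow> int" where
  "walk s k \<omega> n = k + (\<Sum>m<n. s (\<omega> !! m))"

definition time_to_zero :: "('b \<Rightarrow> int) \<Rightarrow> int \<Rightarrow> 'b stream \<Rightarrow> ennreal" where
  "time_to_zero s k \<omega> = (INF n\<in>{n. n \<ge> 1 \<and> walk s k \<omega> n = 0}. of_nat n)"

lemma walk_Cons: "walk s k (x ## \<omega>) (Suc n) = walk s (k + s x) \<omega> n"
  unfolding walk_def sum.lessThan_Suc_shift by simp

text \<open>
  The return time counts from time \<open>1\<close> on, so a walk that is at \<open>0\<close> after its first step needs a
  separate value: no further time is spent, whereas \<open>time_to_zero\<close> started at \<open>0\<close> is at least \<open>1\<close>.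
\<close>

lemma time_to_zero_Cons:
  "1 + (if k + s x = 0 then 0 else time_to_zero s (k + s x) \<omega>) \<le> time_to_zero s k (x ## \<omega>)"
  unfolding time_to_zero_def[of s k]
proof (rule INF_greatest, clarify)
  fix n :: nat
  assume n: "1 \<le> n" "walk s k (x ## \<omega>) n = 0"
  then obtain m where m: "n = Suc m"
    by (cases n) auto
  then have w: "walk s (k + s x) \<omega> m = 0"
    using n(2) by (simp add: walk_Cons)
  have "(if k + s x = 0 then 0 else time_to_zero s (k + s x) \<omega>) \<le> of_nat m"
  proof (cases "k + s x = 0")
    case False
    then have "m \<ge> 1"
      using w by (cases m) (auto simp: walk_def)
    then show ?thesis
      using False w by (auto simp: time_to_zero_def intro!: INF_lower)
  qed simp
  then show "1 + (if k + s x = 0 then 0 else time_to_zero s (k + s x) \<omega>) \<le> of_nat n"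
    by (simp add: m add_mono)
qed

lemma measurable_time_to_zero:
  assumes [measurable]: "s \<in> M \<rightarrow>\<^sub>M count_space UNIV"
  shows "time_to_zero s k \<in> borel_measurable (stream_space M)"
proof -
  have [measurable]: "(\<lambda>\<omega>. walk s k \<omega> n) \<in> stream_space M \<rightarrow>\<^sub>M count_space UNIV" for n
  proof (induction n)
    case (Suc n)
    note [measurable] = this
    have "(\<lambda>\<omega>. walk s k \<omega> n + s (\<omega> !! n)) \<in> stream_space M \<rightarrow>\<^sub>M count_space UNIV"
      by measurable
    then show ?case
      by (simp add: walk_def add.assoc)
  qed (simp add: walk_def)
  have "time_to_zero s k =
      (\<lambda>\<omega>. INF n\<in>{1..}. if walk s k \<omega> n = 0 then of_nat n else \<infinity>)"
  proof (intro ext antisym)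
    show "time_to_zero s k \<omega> \<le> (INF n\<in>{1..}. if walk s k \<omega> n = 0 then of_nat n else \<infinity>)" for \<omega>
      unfolding time_to_zero_def by (rule INF_greatest) (simp add: INF_lower)
    show "(INF n\<in>{1..}. if walk s k \<omega> n = 0 then of_nat n else \<infinity>) \<le> time_to_zero s k \<omega>" for \<omega>
      unfolding time_to_zero_def
    proof (rule INF_greatest)
      fix n assume "n \<in> {n. n \<ge> 1 \<and> walk s k \<omega> n = 0}"
      then show "(INF n\<in>{1..}. if walk s k \<omega> n = 0 then of_nat n else \<infinity>) \<le> (of_nat n :: ennreal)"
        by (intro INF_lower2[where i = n]) simp_all
    qed
  qed
  then show ?thesis
    by (simp only:) measurable
qed

text \<open>
  The first step leads from \<open>0\<close> to \<open>1\<close> with positive probability, and from \<open>1\<close> the mean time to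
  reach \<open>0\<close> is infinite, since conditioning on one step shows that the mean times satisfy the
  drift inequality above.
\<close>

lemma (in prob_space) nn_integral_time_to_zero_eq_infinity:
  assumes s[measurable]: "s \<in> M \<rightarrow>\<^sub>M count_space UNIV"
    and range: "\<And>x. x \<in> space M \<Longrightarrow> s x \<in> {1, -1, 0}"
    and pos: "0 < prob {x \<in> space M. s x = 1}"
    and le: "prob {x \<in> space M. s x = -1} \<le> prob {x \<in> space M. s x = 1}"
  shows "(\<integral>\<^sup>+\<omega>. time_to_zero s 0 \<omega> \<partial>stream_space M) = \<infinity>"
proof -
  interpret S: prob_space "stream_space M"
    by (rule prob_space_stream_space)
  note measurable_time_to_zero[OF s, measurable]
  define A where "A a = {x \<in> space M. s x = a}" for a
  have A[measurable]: "A a \<in> sets M" for a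
    unfolding A_def by measurable
  define p where "p = prob (A 1)"
  define q where "q = prob (A (-1))"
  have A_disj: "A 1 \<inter> A (-1) = {}" and A0: "A 0 = space M - (A 1 \<union> A (-1))"
    using range by (auto simp: A_def)
  have pq: "prob (A 1 \<union> A (-1)) = p + q"
    using finite_measure_Union[OF A A A_disj] by (simp add: p_def q_def)
  then have r: "prob (A 0) = 1 - p - q"
    unfolding A0 by (subst prob_compl) auto
  define g where
    "g k = (if k = 0 then 0 else \<integral>\<^sup>+\<omega>. time_to_zero s k \<omega> \<partial>stream_space M)" for k
  have indicat: "(\<integral>\<^sup>+x. c * indicator (A a) x \<partial>M) = ennreal (prob (A a)) * c" for a c
    by (subst nn_integral_cmult_indicator) (simp_all add: emeasure_eq_measure mult.commute)
  have step: "1 + ennreal p * g (k + 1) + ennreal q * g (k - 1) + ennreal (1 - p - q) * g k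
      \<le> (\<integral>\<^sup>+\<omega>. time_to_zero s k \<omega> \<partial>stream_space M)" for k
  proof -
    have "1 + ennreal p * g (k + 1) + ennreal q * g (k - 1) + ennreal (1 - p - q) * g k
        = (\<integral>\<^sup>+x. 1 + g (k + 1) * indicator (A 1) x + g (k - 1) * indicator (A (-1)) x
            + g k * indicator (A 0) x \<partial>M)"
      unfolding r[symmetric] by (simp add: nn_integral_add indicat p_def q_def emeasure_space_1)
    also have "\<dots> = (\<integral>\<^sup>+x. 1 + g (k + s x) \<partial>M)"
      using range by (intro nn_integral_cong) (fastforce simp: A_def indicator_def)
    also have "\<dots> = (\<integral>\<^sup>+x. (\<integral>\<^sup>+\<omega>. 1 + (if k + s x = 0 then 0 else time_to_zero s (k + s x) \<omega>)
        \<partial>stream_space M) \<partial>M)"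
      by (intro nn_integral_cong) (simp add: g_def nn_integral_add S.emeasure_space_1)
    also have "\<dots> \<le> (\<integral>\<^sup>+x. (\<integral>\<^sup>+\<omega>. time_to_zero s k (x ## \<omega>) \<partial>stream_space M) \<partial>M)"
      by (intro nn_integral_mono time_to_zero_Cons)
    also have "\<dots> = (\<integral>\<^sup>+\<omega>. time_to_zero s k \<omega> \<partial>stream_space M)"
      by (rule nn_integral_stream_space[symmetric]) measurable
    finally show ?thesis .
  qed
  have p_pos: "0 < p"
    using pos by (simp add: p_def A_def)
  have "g (int 1) = \<infinity>"
  proof (rule drift_inequality_infinite[of p q "\<lambda>k. g (int k)"])
    show "p + q \<le> 1"
      using pq prob_le_1 by metis
    show "q \<le> p"
      using le by (simp add: p_def q_def A_def)
    show "1 + ennreal p * g (int (k + 2)) + ennreal q * g (int k)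
        + ennreal (1 - p - q) * g (int (k + 1)) \<le> g (int (k + 1))" for k
    proof -
      have "int (k + 1) + 1 = int (k + 2)" "int (k + 1) - 1 = int k"
        and "g (int (k + 1)) = (\<integral>\<^sup>+\<omega>. time_to_zero s (int (k + 1)) \<omega> \<partial>stream_space M)"
        by (simp_all add: g_def)
      then show ?thesis
        using step[of "int (k + 1)"] by (simp only:)
    qed
  qed (use p_pos in \<open>simp_all add: q_def g_def\<close>)
  then have "1 + ennreal p * g (0 + 1) + ennreal q * g (0 - 1) + ennreal (1 - p - q) * g 0 = \<infinity>"
    using p_pos by (simp add: ennreal_mult_top)
  with step[of 0] show ?thesis
    by (simp only: infinity_ennreal_def top_unique)
qed

section \<open>The class difference in the buffer is a walk\<close>

definition excess :: "'a \<Rightarrow> 'a \<Rightarrow> 'a list \<Rightarrow> int" where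
  "excess i j w = int (count_list w i) - int (count_list w j)"

definition class_step :: "'a \<Rightarrow> 'a \<Rightarrow> 'a \<times> 'b \<Rightarrow> int" where
  "class_step i j x = of_bool (fst x = i) - of_bool (fst x = j)"

lemma count_list_nths:
  "count_list (nths w A) x = card {p. p < length w \<and> p \<in> A \<and> w ! p = x}"
proof (induction w rule: rev_induct)
  case (snoc a w)
  have "{p. p < length (w @ [a]) \<and> p \<in> A \<and> (w @ [a]) ! p = x} =
      {p. p < length w \<and> p \<in> A \<and> w ! p = x} \<union> (if length w \<in> A \<and> a = x then {length w} else {})"
    by (auto simp: nth_append less_Suc_eq split: if_splits)
  then show ?case
    using snoc by (auto simp: nths_append)
qed simp

lemma count_list_nths_Compl:
  "count_list (nths w A) x + count_list (nths w (- A)) x = count_list w x"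
proof -
  have "card {p. p < length w \<and> p \<in> A \<and> w ! p = x} + card {p. p < length w \<and> p \<in> - A \<and> w ! p = x}
      = card ({p. p < length w \<and> p \<in> A \<and> w ! p = x} \<union> {p. p < length w \<and> p \<in> - A \<and> w ! p = x})"
    by (intro card_Un_disjoint[symmetric]) auto
  also have "{p. p < length w \<and> p \<in> A \<and> w ! p = x} \<union> {p. p < length w \<and> p \<in> - A \<and> w ! p = x}
      = {p. p < length w \<and> p \<in> UNIV \<and> w ! p = x}"
    by auto
  finally show ?thesis
    by (simp only: count_list_nths[symmetric]) (simp add: nths_all)
qed

lemma count_list_nths_inj_on:
  assumes "S \<subseteq> {..<length w}" "inj_on ((!) w) S"
  shows "count_list (nths w S) x = of_bool (x \<in> (!) w ` S)"
proof (cases "x \<in> (!) w ` S")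
  case True
  then obtain p where "p \<in> S" "w ! p = x"
    by auto
  then have "{p. p < length w \<and> p \<in> S \<and> w ! p = x} = {p}"
    using assms by (auto simp: inj_on_def)
  then show ?thesis
    using True by (simp add: count_list_nths)
next
  case False
  then have "{p. p < length w \<and> p \<in> S \<and> w ! p = x} = {}"
    by auto
  then show ?thesis
    using False by (simp only: count_list_nths) simp
qed

text \<open>
  The matched items together with the incoming one form a hyperedge, which contains as many items
  of class \<open>i\<close> as of class \<open>j\<close>; so a match affects the excess exactly as storing the item would.
\<close>

lemma excess_match:
  assumes twins: "\<And>K. K \<in> E \<Longrightarrow> i \<in> K \<longleftrightarrow> j \<in> K"
    and S: "S \<in> matches E w c"
  shows "excess i j (nths w (- S)) = excess i j w + class_step i j (c, u)"
proof -
  have c: "c \<notin> (!) w ` S" and K: "insert c ((!) w ` S) \<in> E"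
    using S by (auto simp: matches_def)
  have "count_list w x = of_bool (x \<in> (!) w ` S) + count_list (nths w (- S)) x" for x
    using S count_list_nths_Compl[of w S x] count_list_nths_inj_on[of S w x]
    by (simp add: matches_def)
  moreover have "i = c \<or> i \<in> (!) w ` S \<longleftrightarrow> j = c \<or> j \<in> (!) w ` S"
    using twins[OF K] by blast
  ultimately show ?thesis
    using c by (auto simp: excess_def class_step_def)
qed

text \<open>
  If storing the item completed a hyperedge \<open>K\<close>, one stored position for each class of \<open>K\<close> other
  than that of the item would have been a possible match.
\<close>

lemma buffer_words_append_unmatched:
  assumes w: "w \<in> buffer_words V E" and c: "c \<in> V" and unmatched: "matches E w c = {}"
  shows "w @ [c] \<in> buffer_words V E"
proof -
  have "\<not> K \<subseteq> set (w @ [c])" if K: "K \<in> E" for K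
  proof
    assume sub: "K \<subseteq> set (w @ [c])"
    have "\<not> K \<subseteq> set w"
      using w K by (auto simp: buffer_words_def)
    then have "c \<in> K"
      using sub by auto
    have "K - {c} \<subseteq> (!) w ` {..<length w}"
      using sub by (force simp: in_set_conv_nth)
    then obtain S where "S \<subseteq> {..<length w}" "inj_on ((!) w) S" "K - {c} = (!) w ` S"
      by (auto simp: subset_image_inj)
    moreover from this \<open>c \<in> K\<close> K have "c \<notin> (!) w ` S" "insert c ((!) w ` S) \<in> E"
      by (metis Diff_iff insertI1, metis insert_Diff)
    ultimately have "S \<in> matches E w c"
      by (simp add: matches_def)
    then show False
      using unmatched by simp
  qed
  then show ?thesis
    using w c by (simp add: buffer_words_def)
qed

lemma next_word_step:
  assumes adm: "admissible V E \<Phi>"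
    and twins: "\<And>K. K \<in> E \<Longrightarrow> i \<in> K \<longleftrightarrow> j \<in> K"
    and w: "w \<in> buffer_words V E" and x: "fst x \<in> V" "snd x \<in> {0..1}"
  shows "next_word E \<Phi> w x \<in> buffer_words V E"
    and "excess i j (next_word E \<Phi> w x) = excess i j w + class_step i j x"
proof -
  obtain c u where cu: "x = (c, u)"
    by (cases x)
  have "next_word E \<Phi> w x \<in> buffer_words V E \<and>
      excess i j (next_word E \<Phi> w x) = excess i j w + class_step i j x"
  proof (cases "matches E w c = {}")
    case True
    then show ?thesis
      using buffer_words_append_unmatched[OF w] x
      by (simp add: cu next_word_def excess_def class_step_def)
  next
    case False
    then have "\<Phi> w c \<in> uniform_draw \<rightarrow>\<^sub>M count_space (matches E w c)"
      using adm w x by (simp add: admissible_def cu)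
    from measurable_space[OF this, of u] have "\<Phi> w c u \<in> matches E w c"
      using x by (simp add: cu uniform_draw_def)
    moreover have "nths w (- \<Phi> w c u) \<in> buffer_words V E"
      using w set_nths_subset[of w "- \<Phi> w c u"] by (fastforce simp: buffer_words_def)
    ultimately show ?thesis
      using excess_match[OF twins] False by (simp add: cu next_word_def)
  qed
  then show "next_word E \<Phi> w x \<in> buffer_words V E"
    and "excess i j (next_word E \<Phi> w x) = excess i j w + class_step i j x"
    by auto
qed

lemma excess_buffer:
  assumes adm: "admissible V E \<Phi>"
    and twins: "\<And>K. K \<in> E \<Longrightarrow> i \<in> K \<longleftrightarrow> j \<in> K"
    and w: "w \<in> buffer_words V E" and \<omega>: "\<omega> \<in> streams (V \<times> {0..1})"
  shows "excess i j (buffer E \<Phi> w \<omega> n) = walk (class_step i j) (excess i j w) \<omega> n"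
proof -
  have "buffer E \<Phi> w \<omega> n \<in> buffer_words V E \<and>
      excess i j (buffer E \<Phi> w \<omega> n) = walk (class_step i j) (excess i j w) \<omega> n"
  proof (induction n)
    case (Suc n)
    have "\<omega> !! n \<in> V \<times> {0..1}"
      using \<omega> by (rule snth_in)
    then have "fst (\<omega> !! n) \<in> V" "snd (\<omega> !! n) \<in> {0..1}"
      by auto
    note next_word_step[OF adm twins _ this, of "buffer E \<Phi> w \<omega> n"]
    then show ?case
      using Suc by (simp add: walk_def)
  qed (use w in \<open>simp add: walk_def\<close>)
  then show ?thesis ..
qed

lemma time_to_zero_le_return_time:
  assumes "admissible V E \<Phi>" "\<And>K. K \<in> E \<Longrightarrow> i \<in> K \<longleftrightarrow> j \<in> K"
    and "w \<in> buffer_words V E" "\<omega> \<in> streams (V \<times> {0..1})" "excess i j w = 0"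
  shows "time_to_zero (class_step i j) 0 \<omega> \<le> return_time E \<Phi> w \<omega>"
proof -
  have "walk (class_step i j) 0 \<omega> n = 0" if "buffer E \<Phi> w \<omega> n = w" for n
    using excess_buffer[OF assms(1-4), of n] assms(5) that by simp
  then show ?thesis
    unfolding time_to_zero_def return_time_def by (intro INF_superset_mono) auto
qed

section \<open>Instability\<close>

lemma prob_space_uniform_draw: "prob_space uniform_draw"
  by (rule prob_spaceI) (simp add: uniform_draw_def emeasure_restrict_space)

text \<open>
  The return time is bounded below pointwise by that of the walk; the latter depends on the
  arrivals alone, whose steps have the law required above.
\<close>

lemma mean_return_time_infinite:
  assumes adm: "admissible V E \<Phi>"
    and twins: "\<And>K. K \<in> E \<Longrightarrow> i \<in> K \<longleftrightarrow> j \<in> K"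
    and ij: "i \<in> V" "j \<in> V" "i \<noteq> j"
    and \<mu>: "\<mu> \<in> full_support_measures V"
    and le: "measure \<mu> {j} \<le> measure \<mu> {i}"
    and w: "w \<in> buffer_words V E" "excess i j w = 0"
  shows "(\<integral>\<^sup>+\<omega>. return_time E \<Phi> w \<omega> \<partial>arrivals \<mu>) = \<infinity>"
proof -
  have sets_\<mu>: "sets \<mu> = Pow V" and pos: "0 < measure \<mu> {i}"
    using \<mu> ij by (auto simp: full_support_measures_def)
  then have space_\<mu>: "space \<mu> = V"
    by (metis Pow_iff Pow_top sets.sets_into_space sets.top subset_antisym)
  interpret \<mu>: prob_space \<mu>
    using \<mu> by (simp add: full_support_measures_def)
  interpret U: prob_space uniform_draw
    by (rule prob_space_uniform_draw)
  let ?M = "\<mu> \<Otimes>\<^sub>M uniform_draw"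
  interpret P: pair_prob_space \<mu> uniform_draw ..
  have space_M: "space ?M = V \<times> {0..1}"
    by (simp add: space_pair_measure space_\<mu> uniform_draw_def)
  have "\<mu> \<rightarrow>\<^sub>M count_space UNIV = (V \<rightarrow> UNIV :: ('a \<Rightarrow> int) set)"
    by (auto simp: measurable_def space_\<mu> sets_\<mu>)
  then have [measurable]: "(\<lambda>c. of_bool (c = i) - of_bool (c = j) :: int) \<in> \<mu> \<rightarrow>\<^sub>M count_space UNIV"
    by simp
  have s: "class_step i j \<in> ?M \<rightarrow>\<^sub>M count_space UNIV"
    unfolding class_step_def by measurable
  have cyl: "measure ?M ({c} \<times> space uniform_draw) = measure \<mu> {c}" if "c \<in> V" for c
    using that sets_\<mu> by (simp add: measure_def U.emeasure_pair_measure_Times U.emeasure_space_1)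
  have up: "{x \<in> space ?M. class_step i j x = 1} = {i} \<times> space uniform_draw"
    and down: "{x \<in> space ?M. class_step i j x = -1} = {j} \<times> space uniform_draw"
    using ij by (auto simp: space_pair_measure space_\<mu> class_step_def of_bool_def split: if_splits)
  have "\<infinity> = (\<integral>\<^sup>+\<omega>. time_to_zero (class_step i j) 0 \<omega> \<partial>arrivals \<mu>)"
    unfolding arrivals_def
  proof (rule P.nn_integral_time_to_zero_eq_infinity[OF s, symmetric])
    show "class_step i j x \<in> {1, -1, 0}" for x :: "'a \<times> real"
      by (simp add: class_step_def of_bool_def)
  qed (use ij pos le in \<open>simp_all only: up down cyl\<close>)
  also have "\<dots> \<le> (\<integral>\<^sup>+\<omega>. return_time E \<Phi> w \<omega> \<partial>arrivals \<mu>)"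
    using time_to_zero_le_return_time[OF adm twins w(1) _ w(2)]
    by (intro nn_integral_mono) (simp add: arrivals_def space_stream_space space_M)
  finally show ?thesis
    by (simp add: top_unique)
qed

lemma node_degree_1_unique:
  assumes "node_degree E i = 1" "H \<in> E" "i \<in> H" "K \<in> E" "i \<in> K"
  shows "K = H"
  using assms unfolding node_degree_def
  by (metis (mono_tags, lifting) card_1_singletonE mem_Collect_eq singletonD)

theorem proposition4p4:
  fixes V :: "'a set" and E :: "'a set set" and \<Phi> :: "'a policy"
  assumes "hypergraph V E"
    and "simple_hypergraph E"
    and "connected_hypergraph E"
    and "\<exists>H\<in>E. \<exists>i\<in>H. \<exists>j\<in>H. i \<noteq> j \<and> node_degree E i = 1 \<and> node_degree E j = 1"
    and "admissible V E \<Phi>"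
  shows "Stab V E \<Phi> = {}"
proof (rule ccontr)
  assume "Stab V E \<Phi> \<noteq> {}"
  then obtain \<mu> where \<mu>: "\<mu> \<in> full_support_measures V" and "stable V E \<Phi> \<mu>"
    by (auto simp: Stab_def)
  obtain H i j where H: "H \<in> E" "i \<in> H" "j \<in> H" and "i \<noteq> j"
    and deg: "node_degree E i = 1" "node_degree E j = 1"
    using assms(4) by auto
  have twins: "i \<in> K \<longleftrightarrow> j \<in> K" if "K \<in> E" for K
    using node_degree_1_unique[OF deg(1) H(1,2) that] node_degree_1_unique[OF deg(2) H(1,3) that] H
    by blast
  have V: "i \<in> V" "j \<in> V"
    using assms(1) H by (auto simp: hypergraph_def)
  \<comment> \<open>By simplicity: an empty hyperedge would be properly contained in \<open>H\<close>.\<close>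
  have "{} \<notin> E"
    using assms(2) H by (auto simp: simple_hypergraph_def)
  then have nil: "[] \<in> buffer_words V E"
    by (auto simp: buffer_words_def)
  have "(\<integral>\<^sup>+\<omega>. return_time E \<Phi> [] \<omega> \<partial>arrivals \<mu>) = \<infinity>"
    \<comment> \<open>The more frequent of the two classes has to drive the walk upwards.\<close>
  proof (cases "measure \<mu> {j} \<le> measure \<mu> {i}")
    case True
    then show ?thesis
      using mean_return_time_infinite[OF assms(5) twins V \<open>i \<noteq> j\<close> \<mu> _ nil] by (simp add: excess_def)
  next
    case False
    then show ?thesis
      using mean_return_time_infinite[OF assms(5) twins[symmetric] V(2,1) \<open>i \<noteq> j\<close>[symmetric] \<mu> _ nil]
      by (simp add: excess_def)
  qed
  then show False
    using \<open>stable V E \<Phi> \<mu>\<close> nil by (auto simp: stable_def)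
qed

end
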